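(* (Monotone Convergence Theorem.) Let $X$ be a Banach space over $\mathbb{C}$, $(\Omega,\Sigma)$ a measurable space, and $\mu=\{\mu_\Lambda \mid \Lambda\in X^*\}$ a vector projection family. Let $(f_n)_{n\in\mathbb{N}}$ be a non-decreasing sequence of non-negative functions in $L^1(\mu)$ such that $f_n\to f$ pointwise. If $f\in L^1(\mu)$, then $$\int f_n\,d\mu\to\int f\,d\mu$$ in the weak-$*$ topology of $X^{**}$.
   Context: $\mathcal{M}(\Omega)$ is the space of complex measures on $(\Omega,\Sigma)$. A net $(\mu_i)$ in $\mathcal{M}(\Omega)$ converges setwise to $\mu$ if $\mu_i(E)\to\mu(E)$ for every $E\in\Sigma$. A vector projection family is a collection $\{\mu_\Lambda \mid \Lambda\in X^*\}\subset\mathcal{M}(\Omega)$ such that (1) $\Lambda\mapsto\mu_\Lambda$ is linear from $X^*$ to $\mathcal{M}(\Omega)$; (2) if a net $(\Lambda_i)$ in $X^*$ converges in norm to $\Lambda$, then $\mu_{\Lambda_i}\to\mu_\Lambda$ setwise. A measurable $f\colon\Omega\to\mathbb{C}$ belongs to $L^1(\mu)$ if $f\in L^1(\mu_\Lambda)$ (that is, $\int|f|\,d|\mu_\Lambda|<\infty$) for each $\Lambda\in X^*$. For $f\in L^1(\mu)$, the integral $\int f\,d\mu$ is the map $X^*\to\mathbb{C}$, $\Lambda\mapsto\int_\Omega f\,d\mu_\Lambda$; it is an element of $X^{**}$. The weak-$*$ topology of $X^{**}$ is the topology of pointwise convergence on $X^*$. *)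

theory Defs
  imports "HOL-Analysis.Analysis"
begin

text \<open>Complex normed and Banach spaces. The library only provides the real versions.\<close>

class complex_normed_vector = real_normed_vector +
  fixes scaleC :: "complex \<Rightarrow> 'a \<Rightarrow> 'a" (infixr \<open>*\<^sub>C\<close> 75)
  assumes scaleC_add_right: "a *\<^sub>C (x + y) = a *\<^sub>C x + a *\<^sub>C y"
    and scaleC_add_left: "(a + b) *\<^sub>C x = a *\<^sub>C x + b *\<^sub>C x"
    and scaleC_scaleC: "a *\<^sub>C b *\<^sub>C x = (a * b) *\<^sub>C x"
    and scaleR_scaleC: "r *\<^sub>R x = complex_of_real r *\<^sub>C x"
    and norm_scaleC: "norm (a *\<^sub>C x) = cmod a * norm x"

class complex_banach = complex_normed_vector + banach

instantiation complex :: complex_banach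
begin

definition scaleC_complex :: "complex \<Rightarrow> complex \<Rightarrow> complex" where
  "scaleC_complex a x = a * x"

instance
  by standard (simp_all add: scaleC_complex_def algebra_simps scaleR_conv_of_real norm_mult)

end

definition bounded_clinear_functional :: "('a::complex_normed_vector \<Rightarrow> complex) \<Rightarrow> bool" where
  "bounded_clinear_functional f \<longleftrightarrow> bounded_linear f \<and> (\<forall>c x. f (c *\<^sub>C x) = c * f x)"


text \<open>The dual space \<open>X\<^sup>*\<close> as a type, carrying the operator norm it inherits from the
  real-linear bounded maps \<open>'a \<Rightarrow>\<^sub>L complex\<close>.\<close>

typedef (overloaded) 'a cdual =
  "{f :: 'a::complex_normed_vector \<Rightarrow>\<^sub>L complex. bounded_clinear_functional (blinfun_apply f)}"
  morphisms blinfun_of_cdual Abs_cdual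
  by (rule exI[of _ 0]) (simp add: bounded_clinear_functional_def blinfun.bounded_linear_right)

setup_lifting type_definition_cdual

definition cdual_apply :: "'a::complex_normed_vector cdual \<Rightarrow> 'a \<Rightarrow> complex" where
  "cdual_apply \<Lambda> = blinfun_apply (blinfun_of_cdual \<Lambda>)"

lift_definition scaleC_blinfun :: "complex \<Rightarrow> ('a::real_normed_vector \<Rightarrow>\<^sub>L complex) \<Rightarrow> 'a \<Rightarrow>\<^sub>L complex"
  is "\<lambda>c f x. c * f x"
  by (rule bounded_linear_const_mult)

lemma norm_scaleC_blinfun: "norm (scaleC_blinfun c f) = cmod c * norm f"
proof -
  have le: "norm (scaleC_blinfun d g) \<le> cmod d * norm g" for d and g :: "'a \<Rightarrow>\<^sub>L complex"
    by (rule norm_blinfun_bound)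
      (auto simp: scaleC_blinfun.rep_eq norm_mult mult.assoc intro!: mult_left_mono norm_blinfun)
  show ?thesis
  proof (cases "c = 0")
    case True
    then show ?thesis using le[of c f] by simp
  next
    case False
    have "f = scaleC_blinfun (inverse c) (scaleC_blinfun c f)"
      using False by (intro blinfun_eqI) (simp add: scaleC_blinfun.rep_eq)
    then have "norm f \<le> cmod (inverse c) * norm (scaleC_blinfun c f)"
      using le by metis
    then have "cmod c * norm f \<le> norm (scaleC_blinfun c f)"
      using False by (simp add: norm_divide inverse_eq_divide field_simps)
    with le[of c f] show ?thesis by simp
  qed
qed

instantiation cdual :: (complex_normed_vector) complex_normed_vector
begin

lift_definition zero_cdual :: "'a cdual" is 0
  by (simp add: bounded_clinear_functional_def blinfun.bounded_linear_right)

lift_definition plus_cdual :: "'a cdual \<Rightarrow> 'a cdual \<Rightarrow> 'a cdual" is "(+)"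
  by (auto simp: bounded_clinear_functional_def blinfun.bilinear_simps algebra_simps
      intro: blinfun.bounded_linear_right bounded_linear_add)

lift_definition minus_cdual :: "'a cdual \<Rightarrow> 'a cdual \<Rightarrow> 'a cdual" is "(-)"
  by (auto simp: bounded_clinear_functional_def blinfun.bilinear_simps algebra_simps
      intro: blinfun.bounded_linear_right bounded_linear_sub)

lift_definition uminus_cdual :: "'a cdual \<Rightarrow> 'a cdual" is uminus
  by (auto simp: bounded_clinear_functional_def blinfun.bilinear_simps
      intro: blinfun.bounded_linear_right bounded_linear_minus)

lift_definition scaleR_cdual :: "real \<Rightarrow> 'a cdual \<Rightarrow> 'a cdual" is "(*\<^sub>R)"
  by (auto simp: bounded_clinear_functional_def blinfun.bilinear_simps
      intro: blinfun.bounded_linear_right bounded_linear_const_scaleR)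

lift_definition scaleC_cdual :: "complex \<Rightarrow> 'a cdual \<Rightarrow> 'a cdual" is scaleC_blinfun
  by (auto simp: bounded_clinear_functional_def scaleC_blinfun.rep_eq
      intro: bounded_linear_const_mult)

lift_definition norm_cdual :: "'a cdual \<Rightarrow> real" is norm .

lift_definition sgn_cdual :: "'a cdual \<Rightarrow> 'a cdual" is sgn
  by (auto simp: bounded_clinear_functional_def blinfun.bilinear_simps sgn_div_norm
      intro: blinfun.bounded_linear_right bounded_linear_const_scaleR)

lift_definition dist_cdual :: "'a cdual \<Rightarrow> 'a cdual \<Rightarrow> real" is dist .

definition uniformity_cdual :: "('a cdual \<times> 'a cdual) filter" where
  "uniformity_cdual = (INF e\<in>{0 <..}. principal {(x, y). dist x y < e})"

definition open_cdual :: "'a cdual set \<Rightarrow> bool" where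
  "open_cdual S = (\<forall>x\<in>S. \<forall>\<^sub>F (x', y) in uniformity. x' = x \<longrightarrow> y \<in> S)"

instance
proof
  fix x y z :: "'a cdual" and a b :: real and c d :: complex and S :: "'a cdual set"
  show "x + y + z = x + (y + z)" "x + y = y + x" "0 + x = x" "- x + x = 0" "x - y = x + - y"
    "a *\<^sub>R (x + y) = a *\<^sub>R x + a *\<^sub>R y" "(a + b) *\<^sub>R x = a *\<^sub>R x + b *\<^sub>R x"
    "a *\<^sub>R b *\<^sub>R x = (a * b) *\<^sub>R x" "1 *\<^sub>R x = x"
    by (transfer; simp add: algebra_simps)+
  show "dist x y = norm (x - y)"
    by transfer (simp add: dist_norm)
  show "sgn x = inverse (norm x) *\<^sub>R x"
    by transfer (simp add: sgn_div_norm)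
  show "norm x = 0 \<longleftrightarrow> x = 0" "norm (a *\<^sub>R x) = \<bar>a\<bar> * norm x"
    by (transfer; simp)+
  show "norm (x + y) \<le> norm x + norm y"
    by transfer (rule norm_triangle_ineq)
  show "uniformity = (INF e\<in>{0 <..}. principal {(x::'a cdual, y). dist x y < e})"
    by (rule uniformity_cdual_def)
  show "open S = (\<forall>x\<in>S. \<forall>\<^sub>F (x', y) in uniformity. x' = x \<longrightarrow> y \<in> S)"
    by (rule open_cdual_def)
  show "c *\<^sub>C (x + y) = c *\<^sub>C x + c *\<^sub>C y" "(c + d) *\<^sub>C x = c *\<^sub>C x + d *\<^sub>C x"
    "c *\<^sub>C d *\<^sub>C x = (c * d) *\<^sub>C x" "a *\<^sub>R x = complex_of_real a *\<^sub>C x"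
    by (transfer; auto intro!: blinfun_eqI
        simp: scaleC_blinfun.rep_eq blinfun.bilinear_simps algebra_simps scaleR_conv_of_real)+
  show "norm (c *\<^sub>C x) = cmod c * norm x"
    by transfer (rule norm_scaleC_blinfun)
qed

end


text \<open>The weak-* topology on the dual of \<open>'y\<close>: the topology \<open>euclidean\<close> of a function type is
  the product topology, i.e. that of pointwise convergence. For \<open>'y = 'x cdual\<close> the carrier is
  the bidual \<open>X\<^sup>*\<^sup>*\<close>.\<close>

definition weak_star_topology :: "('y::complex_normed_vector \<Rightarrow> complex) topology" where
  "weak_star_topology = subtopology euclidean (Collect bounded_clinear_functional)"


text \<open>Complex measures are set functions that are countably additive on \<open>sets M\<close>; values outside
  \<open>sets M\<close> are irrelevant. Of \<open>M\<close> only \<open>space M\<close> and \<open>sets M\<close> are used.\<close>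

definition complex_measure :: "'w measure \<Rightarrow> ('w set \<Rightarrow> complex) \<Rightarrow> bool" where
  "complex_measure M \<nu> \<longleftrightarrow>
    (\<forall>A :: nat \<Rightarrow> 'w set. range A \<subseteq> sets M \<longrightarrow> disjoint_family A \<longrightarrow> (\<lambda>i. \<nu> (A i)) sums \<nu> (\<Union>i. A i))"

definition setwise_tendsto ::
    "'w measure \<Rightarrow> ('i \<Rightarrow> 'w set \<Rightarrow> complex) \<Rightarrow> ('w set \<Rightarrow> complex) \<Rightarrow> 'i filter \<Rightarrow> bool" where
  "setwise_tendsto M \<nu> \<nu>' F \<longleftrightarrow> (\<forall>E\<in>sets M. ((\<lambda>i. \<nu> i E) \<longlongrightarrow> \<nu>' E) F)"

text \<open>The total variation \<open>|\<nu>|\<close>, the supremum being over countable measurable partitions of \<open>E\<close>.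
  For a complex measure \<open>\<nu>\<close> this set function is a finite measure, so \<open>measure_of\<close> (which falls
  back to the zero measure otherwise) does return it.\<close>

definition total_variation :: "'w measure \<Rightarrow> ('w set \<Rightarrow> complex) \<Rightarrow> 'w measure" where
  "total_variation M \<nu> = measure_of (space M) (sets M)
    (\<lambda>E. SUP A\<in>{A :: nat \<Rightarrow> 'w set. range A \<subseteq> sets M \<and> disjoint_family A \<and> (\<Union>i. A i) = E}.
       \<Sum>i. ennreal (cmod (\<nu> (A i))))"

text \<open>The positive variation \<open>(|\<nu>| + \<nu>) / 2\<close> of a real (signed) measure; the negative variation
  \<open>(|\<nu>| - \<nu>) / 2\<close> is the positive variation of \<open>- \<nu>\<close>.\<close>

definition positive_variation :: "'w measure \<Rightarrow> ('w set \<Rightarrow> real) \<Rightarrow> 'w measure" where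
  "positive_variation M \<nu> = measure_of (space M) (sets M)
    (\<lambda>E. ennreal ((measure (total_variation M (\<lambda>A. complex_of_real (\<nu> A))) E + \<nu> E) / 2))"

definition complex_measure_integral ::
    "'w measure \<Rightarrow> ('w set \<Rightarrow> complex) \<Rightarrow> ('w \<Rightarrow> complex) \<Rightarrow> complex" where
  "complex_measure_integral M \<nu> f =
    (integral\<^sup>L (positive_variation M (\<lambda>E. Re (\<nu> E))) f
      - integral\<^sup>L (positive_variation M (\<lambda>E. - Re (\<nu> E))) f)
    + \<i> * (integral\<^sup>L (positive_variation M (\<lambda>E. Im (\<nu> E))) f
      - integral\<^sup>L (positive_variation M (\<lambda>E. - Im (\<nu> E))) f)"


text \<open>Convergence along nets is expressed by filters: a net \<open>u\<close> in \<open>X\<^sup>*\<close> enters only through its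
  eventuality filter, which is a filter on \<open>X\<^sup>*\<close> (cf. the lemma below).\<close>

definition vector_projection_family ::
    "'w measure \<Rightarrow> ('x::complex_normed_vector cdual \<Rightarrow> 'w set \<Rightarrow> complex) \<Rightarrow> bool" where
  "vector_projection_family M \<mu> \<longleftrightarrow>
    (\<forall>\<Lambda>. complex_measure M (\<mu> \<Lambda>)) \<and>
    (\<forall>a b \<Lambda> \<Gamma>. \<forall>E\<in>sets M. \<mu> (a *\<^sub>C \<Lambda> + b *\<^sub>C \<Gamma>) E = a * \<mu> \<Lambda> E + b * \<mu> \<Gamma> E) \<and>
    (\<forall>F \<Lambda>. ((\<lambda>\<Gamma>. \<Gamma>) \<longlongrightarrow> \<Lambda>) F \<longrightarrow> setwise_tendsto M \<mu> (\<mu> \<Lambda>) F)"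

lemma vector_projection_family_net:
  assumes "vector_projection_family M \<mu>" "(u \<longlongrightarrow> \<Lambda>) F"
  shows "setwise_tendsto M (\<lambda>i. \<mu> (u i)) (\<mu> \<Lambda>) F"
proof -
  have "((\<lambda>\<Gamma>. \<Gamma>) \<longlongrightarrow> \<Lambda>) (filtermap u F)"
    using assms(2) by (simp add: filterlim_filtermap)
  then have "setwise_tendsto M \<mu> (\<mu> \<Lambda>) (filtermap u F)"
    using assms(1) unfolding vector_projection_family_def by blast
  then show ?thesis
    by (simp add: setwise_tendsto_def filterlim_filtermap)
qed

definition vp_integrable ::
    "'w measure \<Rightarrow> ('x::complex_normed_vector cdual \<Rightarrow> 'w set \<Rightarrow> complex) \<Rightarrow> ('w \<Rightarrow> complex) \<Rightarrow> bool" where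
  "vp_integrable M \<mu> f \<longleftrightarrow> (\<forall>\<Lambda>. integrable (total_variation M (\<mu> \<Lambda>)) f)"

definition vp_integral ::
    "'w measure \<Rightarrow> ('x::complex_normed_vector cdual \<Rightarrow> 'w set \<Rightarrow> complex) \<Rightarrow> ('w \<Rightarrow> complex)
      \<Rightarrow> 'x cdual \<Rightarrow> complex" where
  "vp_integral M \<mu> f = (\<lambda>\<Lambda>. complex_measure_integral M (\<mu> \<Lambda>) f)"

end

(* Each integral against mu_Lambda converges by dominated convergence with dominating function |f|,
   once |mu_Lambda| and the positive variations are known to be genuine measures, those of real set
   functions being finite. The weak-* topology lives on the bounded functionals on X^*, so the
   integrals must also be shown to be bounded in Lambda: each is a pointwise limit of integrals of
   simple functions, which are bounded, and X^* is complete, so Banach-Steinhaus applies. *)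

theory Submission
  imports Defs
begin

text \<open>\<open>positive_variation\<close> is not linear in its argument, so the dependence of
  \<open>complex_measure_integral\<close> on \<Lambda> cannot be read off its four terms. For a
  simple function the pieces of opposite sign recombine into values of the measure itself on level
  sets, and these values are linear and continuous in \<Lambda> by assumption; this is why
  boundedness is reached through simple functions. Finiteness for real set functions matters because
  \<open>positive_variation\<close> is built from \<open>measure\<close>, which sends an infinite
  value to 0. Integrability against the total variation carries over to the four pieces because each
  of them lies below it.\<close>

section \<open>The variation as a measure, and its finiteness for real set functions\<close>

definition variation :: "'w measure \<Rightarrow> ('w set \<Rightarrow> complex) \<Rightarrow> 'w set \<Rightarrow> ennreal" where
  "variation M \<nu> E =
    (SUP A\<in>{A :: nat \<Rightarrow> 'w set. range A \<subseteq> sets M \<and> disjoint_family A \<and> (\<Union>i. A i) = E}.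
      \<Sum>i. ennreal (cmod (\<nu> (A i))))"

lemma variation_upper:
  assumes "range A \<subseteq> sets M" "disjoint_family A" "(\<Union>i. A i) = E"
  shows "(\<Sum>i. ennreal (cmod (\<nu> (A i)))) \<le> variation M \<nu> E"
  unfolding variation_def using assms by (intro SUP_upper) auto

lemma variation_least:
  assumes "\<And>A :: nat \<Rightarrow> 'w set. \<lbrakk>range A \<subseteq> sets M; disjoint_family A; (\<Union>i. A i) = E\<rbrakk>
    \<Longrightarrow> (\<Sum>i. ennreal (cmod (\<nu> (A i)))) \<le> c"
  shows "variation M \<nu> E \<le> c"
  unfolding variation_def using assms by (intro SUP_least) auto

lemma complex_measure_sums:
  assumes "complex_measure M \<nu>" "range A \<subseteq> sets M" "disjoint_family A"
  shows "(\<lambda>i. \<nu> (A i)) sums \<nu> (\<Union>i. A i)"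
  using assms unfolding complex_measure_def by blast

text \<open>The constant family of empty sets is disjoint, so the constant series of its values
  converges and its terms tend to 0.\<close>

lemma complex_measure_empty:
  assumes "complex_measure M \<nu>"
  shows "\<nu> {} = 0"
proof -
  have "(\<lambda>i::nat. \<nu> {}) sums \<nu> (\<Union>i::nat. {})"
    by (rule complex_measure_sums[OF assms]) (auto simp: disjoint_family_on_def)
  then have "(\<lambda>i::nat. \<nu> {}) \<longlonglongrightarrow> 0"
    by (intro summable_LIMSEQ_zero) (auto simp: summable_def)
  then show ?thesis
    by (simp add: LIMSEQ_const_iff)
qed

lemma disjoint_family_binaryset: "A \<inter> B = {} \<Longrightarrow> disjoint_family (binaryset A B)"
  by (auto simp: disjoint_family_on_def binaryset_def split: if_splits)

lemma complex_measure_Un: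
  assumes "complex_measure M \<nu>" "A \<in> sets M" "B \<in> sets M" "A \<inter> B = {}"
  shows "\<nu> (A \<union> B) = \<nu> A + \<nu> B"
proof -
  have "(\<lambda>i. \<nu> (binaryset A B i)) sums \<nu> (\<Union>i. binaryset A B i)"
    using assms by (intro complex_measure_sums disjoint_family_binaryset)
      (auto simp: range_binaryset_eq)
  then show ?thesis
    using binaryset_sums[of \<nu> A B] complex_measure_empty[OF assms(1)] sums_unique2
    by (auto simp: UN_binaryset_eq)
qed

lemma disjoint_family_Int_UN:
  assumes "disjoint_family A" "i \<notin> S"
  shows "A i \<inter> (\<Union>j\<in>S. A j) = {}"
proof -
  have "A i \<inter> A j = {}" if "j \<in> S" for j
    using that assms by (intro disjoint_family_onD[OF assms(1)]) auto
  then show ?thesis by blast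
qed

lemma complex_measure_UN_finite:
  assumes "complex_measure M \<nu>" "finite S" "\<And>i. A i \<in> sets M" "disjoint_family A"
  shows "\<nu> (\<Union>i\<in>S. A i) = (\<Sum>i\<in>S. \<nu> (A i))"
  using assms(2)
proof induction
  case empty
  then show ?case by (simp add: complex_measure_empty[OF assms(1)])
next
  case (insert i S)
  have "\<nu> (A i \<union> (\<Union>i\<in>S. A i)) = \<nu> (A i) + \<nu> (\<Union>i\<in>S. A i)"
  proof (rule complex_measure_Un[OF assms(1)])
    show "A i \<inter> (\<Union>i\<in>S. A i) = {}"
      using insert assms(4) by (intro disjoint_family_Int_UN)
  qed (use insert assms(3) in \<open>auto intro!: sets.finite_UN\<close>)
  then show ?case using insert by simp
qed

text \<open>The partition E, {}, {}, ... already contributes this value to the supremum.\<close>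

lemma norm_complex_measure_le_variation:
  assumes "complex_measure M \<nu>" "E \<in> sets M"
  shows "ennreal (cmod (\<nu> E)) \<le> variation M \<nu> E"
proof -
  have "(\<Sum>i. ennreal (cmod (\<nu> (binaryset E {} i)))) \<le> variation M \<nu> E"
    using assms(2) by (intro variation_upper disjoint_family_binaryset)
      (auto simp: range_binaryset_eq UN_binaryset_eq)
  moreover have "(\<Sum>i. ennreal (cmod (\<nu> (binaryset E {} i)))) = ennreal (cmod (\<nu> E))"
    by (subst suminf_binaryset_eq[where f = "\<lambda>A. ennreal (cmod (\<nu> A))"])
      (simp_all add: complex_measure_empty[OF assms(1)])
  ultimately show ?thesis by simp
qed

text \<open>Absolute convergence is not assumed: where it fails, the right-hand side is
  \<open>top\<close>.\<close>

lemma norm_sums_le_ennreal: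
  fixes f :: "nat \<Rightarrow> 'a::banach"
  assumes "f sums s"
  shows "ennreal (norm s) \<le> (\<Sum>i. ennreal (norm (f i)))"
proof (cases "(\<Sum>i. ennreal (norm (f i))) = top")
  case False
  then have "summable (\<lambda>i. norm (f i))"
    by (intro summable_suminf_not_top) auto
  then have "norm s \<le> (\<Sum>i. norm (f i))"
    using summable_norm assms sums_unique by blast
  then show ?thesis using False by (simp add: ennreal_leI)
qed simp

text \<open>Tonelli for counting measure on the naturals.\<close>

lemma suminf_ennreal_commute:
  fixes f :: "nat \<Rightarrow> nat \<Rightarrow> ennreal"
  shows "(\<Sum>i. \<Sum>j. f i j) = (\<Sum>j. \<Sum>i. f i j)"
proof -
  have "(\<Sum>i. \<Sum>j. f i j) = (\<integral>\<^sup>+i. (\<Sum>j. f i j) \<partial>count_space UNIV)"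
    by (simp add: nn_integral_count_space_nat)
  also have "\<dots> = (\<Sum>j. \<integral>\<^sup>+i. f i j \<partial>count_space UNIV)"
    by (rule nn_integral_suminf) simp
  finally show ?thesis by (simp add: nn_integral_count_space_nat)
qed

text \<open>A partition of \<open>E\<close> and a partition of \<open>F\<close> merge into one
  partition of the union, whose sum is the sum of the two.\<close>

lemma variation_Un_ge:
  assumes \<nu>: "complex_measure M \<nu>" and EF: "E \<inter> F = {}"
  assumes E: "E \<in> sets M" and F: "F \<in> sets M"
  shows "variation M \<nu> E + variation M \<nu> F \<le> variation M \<nu> (E \<union> F)"
proof -
  let ?P = "\<lambda>E. {A :: nat \<Rightarrow> 'a set. range A \<subseteq> sets M \<and> disjoint_family A \<and> (\<Union>i. A i) = E}"
  let ?S = "\<lambda>A::nat \<Rightarrow> 'a set. \<Sum>i. ennreal (cmod (\<nu> (A i)))"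
  have ne: "?P E \<noteq> {}" if "E \<in> sets M" for E
  proof -
    have "binaryset E {} \<in> ?P E"
      using that disjoint_family_binaryset[of E "{}"] by (auto simp: range_binaryset_eq UN_binaryset_eq)
    then show ?thesis by blast
  qed
  have le: "?S A + ?S B \<le> variation M \<nu> (E \<union> F)" if A: "A \<in> ?P E" and B: "B \<in> ?P F" for A B
  proof -
    \<comment> \<open>The two partitions become rows 0 and 1 of a matrix with empty remaining rows;
      \<open>prod_decode\<close> flattens it into one sequence. The padding costs nothing because
      the empty set has value 0.\<close>
    define G where "G = (\<lambda>(m::nat) n. if m = 0 then A n else if m = 1 then B n else {})"
    have G: "G m n = {}" if "m \<notin> {0, 1}" for m n
      using that by (auto simp: G_def)
    have "(\<Sum>i. ennreal (cmod (\<nu> (case_prod G (prod_decode i))))) = (\<Sum>m. ?S (G m))"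
      by (rule suminf_ennreal_2dimen[where f = "\<lambda>x. ennreal (cmod (\<nu> (case_prod G x)))"]) simp
    also have "\<dots> = (\<Sum>m\<in>{0, 1}. ?S (G m))"
      by (rule suminf_finite) (simp_all add: G complex_measure_empty[OF \<nu>])
    also have "\<dots> = ?S A + ?S B"
      by (simp add: G_def)
    finally have "?S A + ?S B = (\<Sum>i. ennreal (cmod (\<nu> (case_prod G (prod_decode i)))))" ..
    also have "\<dots> \<le> variation M \<nu> (E \<union> F)"
    proof (rule variation_upper)
      show "range (\<lambda>i. case_prod G (prod_decode i)) \<subseteq> sets M"
        using A B by (auto simp: G_def split: prod.splits)
      have disj: "G m n \<inter> G m' n' = {}" if "(m, n) \<noteq> (m', n')" for m n m' n'
      proof -
        have "A n \<inter> A n' = {}" "B n \<inter> B n' = {}" if "n \<noteq> n'"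
          using that A B by (auto dest: disjoint_family_onD)
        moreover have "A n \<inter> B n' = {}" "B n \<inter> A n' = {}"
          using A B EF by blast+
        ultimately show ?thesis
          using that unfolding G_def by simp
      qed
      show "disjoint_family (\<lambda>i. case_prod G (prod_decode i))"
        unfolding disjoint_family_on_def
      proof (intro ballI impI)
        fix i j :: nat assume "i \<noteq> j"
        then have "prod_decode i \<noteq> prod_decode j"
          using inj_prod_decode[of UNIV] by (auto simp: inj_on_def)
        then show "case_prod G (prod_decode i) \<inter> case_prod G (prod_decode j) = {}"
          using disj by (cases "prod_decode i"; cases "prod_decode j") auto
      qed
      have "(\<Union>i. case_prod G (prod_decode i)) = (\<Union>x. case_prod G x)"
        by (subst surj_prod_decode[symmetric], subst image_image) (rule refl)
      also have "\<dots> = (\<Union>m. \<Union>n. G m n)"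
        by auto
      also have "\<dots> = (\<Union>n. A n) \<union> (\<Union>n. B n)"
      proof
        show "(\<Union>m. \<Union>n. G m n) \<subseteq> (\<Union>n. A n) \<union> (\<Union>n. B n)"
          by (auto simp: G_def split: if_splits)
        have eq: "(\<Union>n. A n) = (\<Union>n. G 0 n)" "(\<Union>n. B n) = (\<Union>n. G 1 n)"
          by (simp_all add: G_def)
        show "(\<Union>n. A n) \<union> (\<Union>n. B n) \<subseteq> (\<Union>m. \<Union>n. G m n)"
          unfolding eq by (intro Un_least UN_upper[of _ UNIV "\<lambda>m. \<Union>n. G m n"] UNIV_I)
      qed
      finally show "(\<Union>i. case_prod G (prod_decode i)) = E \<union> F"
        using A B by simp
    qed
    finally show ?thesis .
  qed
  \<comment> \<open>The suprema are taken one at a time, over \<open>B\<close> here and over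
    \<open>A\<close> afterwards; adding a constant commutes with each because the index sets are
    nonempty.\<close>
  have "?S A + variation M \<nu> F \<le> variation M \<nu> (E \<union> F)" if A: "A \<in> ?P E" for A
  proof -
    have "?S A + variation M \<nu> F = variation M \<nu> F + ?S A"
      by (rule add.commute)
    also have "\<dots> = (SUP B\<in>?P F. ?S B + ?S A)"
      unfolding variation_def by (rule ennreal_SUP_add_left[OF ne[OF F], symmetric])
    also have "\<dots> \<le> variation M \<nu> (E \<union> F)"
      using le[OF A] by (intro SUP_least) (simp add: add.commute)
    finally show ?thesis .
  qed
  moreover have "variation M \<nu> E + variation M \<nu> F = (SUP A\<in>?P E. ?S A + variation M \<nu> F)"
    unfolding variation_def[of M \<nu> E] by (rule ennreal_SUP_add_left[OF ne[OF E], symmetric])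
  ultimately show ?thesis
    by (auto intro!: SUP_least)
qed

lemma variation_mono:
  assumes "complex_measure M \<nu>" "E \<subseteq> F" "E \<in> sets M" "F \<in> sets M"
  shows "variation M \<nu> E \<le> variation M \<nu> F"
proof -
  have "variation M \<nu> E \<le> variation M \<nu> E + variation M \<nu> (F - E)"
    by simp
  also have "\<dots> \<le> variation M \<nu> (E \<union> (F - E))"
    using assms by (intro variation_Un_ge) auto
  finally show ?thesis
    using assms(2) by (simp add: Un_absorb1)
qed

lemma variation_empty:
  assumes "complex_measure M \<nu>"
  shows "variation M \<nu> {} = 0"
proof -
  have "variation M \<nu> {} \<le> 0"
  proof (rule variation_least)
    fix A :: "nat \<Rightarrow> 'a set"
    assume "(\<Union>i. A i) = {}"
    then show "(\<Sum>i. ennreal (cmod (\<nu> (A i)))) \<le> 0"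
      by (simp add: complex_measure_empty[OF assms])
  qed
  then show ?thesis by simp
qed

text \<open>For one inequality, finite superadditivity and monotonicity bound all partial sums. For
  the other, each piece \<open>A j\<close> of a partition of the union is cut along the sets
  \<open>E i\<close>; exchanging the sums leaves, for each \<open>i\<close>, a partition of
  \<open>E i\<close>.\<close>

lemma countably_additive_variation:
  assumes \<nu>: "complex_measure M \<nu>"
  shows "countably_additive (sets M) (variation M \<nu>)"
  unfolding countably_additive_def
proof (intro allI impI antisym)
  fix E :: "nat \<Rightarrow> 'a set"
  assume E: "range E \<subseteq> sets M" and disj: "disjoint_family E"
  have "(\<Sum>i<n. variation M \<nu> (E i)) \<le> variation M \<nu> (\<Union>i<n. E i)" for n
  proof (induction n)
    case (Suc n)
    have "(\<Sum>i<Suc n. variation M \<nu> (E i)) \<le> variation M \<nu> (\<Union>i<n. E i) + variation M \<nu> (E n)"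
      using Suc by (simp add: add_right_mono)
    also have "\<dots> \<le> variation M \<nu> ((\<Union>i<n. E i) \<union> E n)"
    proof (rule variation_Un_ge[OF \<nu>])
      show "(\<Union>i<n. E i) \<inter> E n = {}"
        using disjoint_family_Int_UN[OF disj, of n "{..<n}"] by (simp add: Int_commute)
    qed (use E in auto)
    finally show ?case by (simp add: lessThan_Suc Un_commute)
  qed simp
  also have "variation M \<nu> (\<Union>i<n. E i) \<le> variation M \<nu> (\<Union>i. E i)" for n
    using E by (intro variation_mono[OF \<nu>]) auto
  finally show "(\<Sum>i. variation M \<nu> (E i)) \<le> variation M \<nu> (\<Union>i. E i)"
    by (intro suminf_le_const) auto
next
  fix E :: "nat \<Rightarrow> 'a set"
  assume E: "range E \<subseteq> sets M" and disj: "disjoint_family E"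
  show "variation M \<nu> (\<Union>i. E i) \<le> (\<Sum>i. variation M \<nu> (E i))"
  proof (rule variation_least)
    fix A :: "nat \<Rightarrow> 'a set"
    assume A: "range A \<subseteq> sets M" "disjoint_family A" "(\<Union>i. A i) = (\<Union>i. E i)"
    have "ennreal (cmod (\<nu> (A j))) \<le> (\<Sum>i. ennreal (cmod (\<nu> (A j \<inter> E i))))" for j
    proof -
      have "(\<lambda>i. \<nu> (A j \<inter> E i)) sums \<nu> (\<Union>i. A j \<inter> E i)"
        using A E by (intro complex_measure_sums[OF \<nu>] disjoint_family_subset[OF disj]) auto
      moreover have "(\<Union>i. A j \<inter> E i) = A j"
        using A(3) by blast
      ultimately show ?thesis
        by (metis norm_sums_le_ennreal)
    qed
    then have "(\<Sum>j. ennreal (cmod (\<nu> (A j)))) \<le> (\<Sum>j. \<Sum>i. ennreal (cmod (\<nu> (A j \<inter> E i))))"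
      by (intro suminf_le) auto
    also have "\<dots> = (\<Sum>i. \<Sum>j. ennreal (cmod (\<nu> (A j \<inter> E i))))"
      by (rule suminf_ennreal_commute)
    also have "\<dots> \<le> (\<Sum>i. variation M \<nu> (E i))"
    proof (intro suminf_le variation_upper)
      fix i
      show "range (\<lambda>j. A j \<inter> E i) \<subseteq> sets M"
        using A E by auto
      show "disjoint_family (\<lambda>j. A j \<inter> E i)"
        by (rule disjoint_family_subset[OF A(2)]) auto
      show "(\<Union>j. A j \<inter> E i) = E i"
        using A(3) by blast
    qed auto
    finally show "(\<Sum>j. ennreal (cmod (\<nu> (A j)))) \<le> (\<Sum>i. variation M \<nu> (E i))" .
  qed
qed

lemma total_variation_eq: "total_variation M \<nu> = measure_of (space M) (sets M) (variation M \<nu>)"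
  unfolding total_variation_def variation_def ..

lemma sets_total_variation [simp, measurable_cong]: "sets (total_variation M \<nu>) = sets M"
  by (simp add: total_variation_eq)

lemma space_total_variation [simp]: "space (total_variation M \<nu>) = space M"
  by (simp add: total_variation_eq)

lemma emeasure_total_variation:
  assumes "complex_measure M \<nu>" "E \<in> sets M"
  shows "emeasure (total_variation M \<nu>) E = variation M \<nu> E"
  using assms
  by (intro emeasure_measure_of[OF total_variation_eq])
    (auto simp: positive_def variation_empty countably_additive_variation sets.space_closed)

text \<open>If \<open>|\<nu>|(E)\<close> is infinite, then the positive or the negative terms of some finite partial sum are
  large. Their union and its complement in \<open>E\<close> both have large \<open>\<nu>\<close>, and one of the two again has
  infinite variation.\<close>

lemma infinite_variation_split:
  assumes \<nu>: "complex_measure M (\<lambda>A. complex_of_real (\<nu> A))"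
    and E: "E \<in> sets M" and inf: "variation M (\<lambda>A. complex_of_real (\<nu> A)) E = \<infinity>"
  obtains B where "B \<in> sets M" "B \<subseteq> E" "variation M (\<lambda>A. complex_of_real (\<nu> A)) B = \<infinity>"
    "1 < \<bar>\<nu> (E - B)\<bar>"
proof -
  let ?V = "variation M (\<lambda>A. complex_of_real (\<nu> A))"
  \<comment> \<open>One of the two sign classes carries more than half of a sum above
    \<open>2 * t\<close>, hence the factor 2. With \<open>t\<close> exceeding \<bar>\<nu> E\<bar> by
    1, a set \<open>C\<close> with \<bar>\<nu> C\<bar> > t also leaves a complement in
    \<open>E\<close> of absolute value above 1.\<close>
  define t where "t = 1 + \<bar>\<nu> E\<bar>"
  then have t: "0 \<le> 2 * t"
    by simp
  have "ennreal (2 * t) < ?V E"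
    using inf by simp
  then obtain A :: "nat \<Rightarrow> 'a set" where A: "range A \<subseteq> sets M" "disjoint_family A" "(\<Union>i. A i) = E"
    and "ennreal (2 * t) < (\<Sum>i. ennreal (cmod (complex_of_real (\<nu> (A i)))))"
    unfolding variation_def less_SUP_iff by auto
  then have "ennreal (2 * t) < (SUP n. \<Sum>i<n. ennreal \<bar>\<nu> (A i)\<bar>)"
    by (simp add: suminf_eq_SUP)
  then obtain n where "ennreal (2 * t) < (\<Sum>i<n. ennreal \<bar>\<nu> (A i)\<bar>)"
    by (auto simp: less_SUP_iff)
  then have n: "2 * t < (\<Sum>i<n. \<bar>\<nu> (A i)\<bar>)"
    using t by (simp add: sum_nonneg ennreal_less_iff)
  have add: "\<nu> (C \<union> D) = \<nu> C + \<nu> D" if "C \<in> sets M" "D \<in> sets M" "C \<inter> D = {}" for C D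
    using complex_measure_Un[OF \<nu> that] by (simp flip: of_real_add)
  have UN: "\<nu> (\<Union>i\<in>S. A i) = (\<Sum>i\<in>S. \<nu> (A i))" if "finite S" for S
    using complex_measure_UN_finite[OF \<nu> that _ A(2)] A(1) by (auto simp flip: of_real_sum)
  define P where "P = {i. i < n \<and> 0 \<le> \<nu> (A i)}"
  define N where "N = {i. i < n \<and> \<nu> (A i) < 0}"
  have PN: "finite P" "finite N" "P \<inter> N = {}" "{..<n} = P \<union> N"
    by (auto simp: P_def N_def)
  have "(\<Sum>i<n. \<bar>\<nu> (A i)\<bar>) = (\<Sum>i\<in>P. \<bar>\<nu> (A i)\<bar>) + (\<Sum>i\<in>N. \<bar>\<nu> (A i)\<bar>)"
    using PN by (simp add: sum.union_disjoint)
  also have "(\<Sum>i\<in>P. \<bar>\<nu> (A i)\<bar>) = \<nu> (\<Union>i\<in>P. A i)"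
    by (simp add: UN PN P_def)
  also have "(\<Sum>i\<in>N. \<bar>\<nu> (A i)\<bar>) = - \<nu> (\<Union>i\<in>N. A i)"
    by (simp add: UN PN sum_negf[symmetric]) (simp add: N_def)
  finally have "t < \<bar>\<nu> (\<Union>i\<in>P. A i)\<bar> \<or> t < \<bar>\<nu> (\<Union>i\<in>N. A i)\<bar>"
    using n by linarith
  then obtain S where S: "finite S" "t < \<bar>\<nu> (\<Union>i\<in>S. A i)\<bar>"
    using PN by blast
  define C where "C = (\<Union>i\<in>S. A i)"
  have C: "C \<in> sets M" "C \<subseteq> E" "t < \<bar>\<nu> C\<bar>"
    using A S by (auto simp: C_def)
  have split: "\<nu> E = \<nu> C + \<nu> (E - C)"
    using add[of C "E - C"] C E by (simp add: Un_absorb1)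
  have big: "1 < \<bar>\<nu> C\<bar>" "1 < \<bar>\<nu> (E - C)\<bar>"
    using C(3) split by (auto simp: t_def)
  have CE: "C \<union> (E - C) = E" "E - C \<in> sets M"
    using C E by auto
  let ?T = "total_variation M (\<lambda>A. complex_of_real (\<nu> A))"
  have "emeasure ?T C + emeasure ?T (E - C) = emeasure ?T (C \<union> (E - C))"
    using C E by (intro plus_emeasure) auto
  then have "?V C + ?V (E - C) = \<infinity>"
    unfolding CE(1) emeasure_total_variation[OF \<nu> E] emeasure_total_variation[OF \<nu> C(1)]
      emeasure_total_variation[OF \<nu> CE(2)] inf .
  then consider "?V C = \<infinity>" | "?V (E - C) = \<infinity>"
    unfolding infinity_ennreal_def ennreal_add_eq_top by blast
  then show thesis
  proof cases
    case 1
    then show thesis using that[of C] C big by blast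
  next
    case 2
    moreover have "E - (E - C) = C"
      using C(2) by blast
    ultimately show thesis using that[of "E - C"] CE(2) big(1) by simp
  qed
qed

text \<open>Iterating the split from the whole space gives a decreasing sequence of sets of infinite
  variation. The successive differences are disjoint and have values above 1 in modulus, yet
  countable additivity forces these values to tend to 0.\<close>

lemma finite_variation:
  assumes \<nu>: "complex_measure M (\<lambda>A. complex_of_real (\<nu> A))"
  shows "variation M (\<lambda>A. complex_of_real (\<nu> A)) (space M) < \<infinity>"
proof (rule ccontr)
  let ?V = "variation M (\<lambda>A. complex_of_real (\<nu> A))"
  assume "\<not> ?V (space M) < \<infinity>"
  then have top: "?V (space M) = \<infinity>"
    by (metis infinity_ennreal_def top.not_eq_extremum)
  have "\<exists>B. \<forall>n. (B n \<in> sets M \<and> ?V (B n) = \<infinity>) \<and> (B (Suc n) \<subseteq> B n \<and> 1 < \<bar>\<nu> (B n - B (Suc n))\<bar>)"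
  proof (rule dependent_nat_choice)
    show "\<exists>B. B \<in> sets M \<and> ?V B = \<infinity>"
      using top by blast
    show "\<exists>B. (B \<in> sets M \<and> ?V B = \<infinity>) \<and> B \<subseteq> E \<and> 1 < \<bar>\<nu> (E - B)\<bar>"
      if "E \<in> sets M \<and> ?V E = \<infinity>" for E and n :: nat
      using infinite_variation_split[OF \<nu>, of E] that by metis
  qed
  then obtain B where B: "\<And>n. B n \<in> sets M" "\<And>n. B (Suc n) \<subseteq> B n" "\<And>n. 1 < \<bar>\<nu> (B n - B (Suc n))\<bar>"
    by blast
  \<comment> \<open>\<open>disjoint_family_Suc\<close> treats increasing sequences, so it is applied
    to the complements of the decreasing \<open>B n\<close>.\<close>
  have "disjoint_family (\<lambda>n. - B (Suc n) - - B n)"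
    using B(2) by (intro disjoint_family_Suc) auto
  moreover have "- B (Suc n) - - B n = B n - B (Suc n)" for n
    by auto
  ultimately have "disjoint_family (\<lambda>n. B n - B (Suc n))"
    by simp
  then have "(\<lambda>n. complex_of_real (\<nu> (B n - B (Suc n)))) sums complex_of_real (\<nu> (\<Union>n. B n - B (Suc n)))"
    using B(1) by (intro complex_measure_sums[OF \<nu>]) auto
  from sums_summable[OF this] have "(\<lambda>n. complex_of_real (\<nu> (B n - B (Suc n)))) \<longlonglongrightarrow> 0"
    by (rule summable_LIMSEQ_zero)
  then have "\<forall>\<^sub>F n in sequentially. norm (complex_of_real (\<nu> (B n - B (Suc n)))) < 1"
    by (simp add: tendsto_iff)
  then obtain n where "norm (complex_of_real (\<nu> (B n - B (Suc n)))) < 1"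
    by (auto simp: eventually_sequentially)
  then show False
    using B(3)[of n] by simp
qed

lemma finite_measure_total_variation:
  assumes "complex_measure M (\<lambda>A. complex_of_real (\<nu> A))"
  shows "finite_measure (total_variation M (\<lambda>A. complex_of_real (\<nu> A)))"
  using finite_variation[OF assms]
  by (intro finite_measureI) (simp add: emeasure_total_variation[OF assms])

lemma abs_le_measure_total_variation:
  assumes \<nu>: "complex_measure M (\<lambda>A. complex_of_real (\<nu> A))" and E: "E \<in> sets M"
  shows "\<bar>\<nu> E\<bar> \<le> measure (total_variation M (\<lambda>A. complex_of_real (\<nu> A))) E"
proof -
  interpret finite_measure "total_variation M (\<lambda>A. complex_of_real (\<nu> A))"
    by (rule finite_measure_total_variation[OF \<nu>])
  have "ennreal \<bar>\<nu> E\<bar> \<le> emeasure (total_variation M (\<lambda>A. complex_of_real (\<nu> A))) E"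
    using norm_complex_measure_le_variation[OF \<nu> E] by (simp add: emeasure_total_variation[OF \<nu> E])
  then show ?thesis
    by (simp add: emeasure_eq_measure)
qed

section \<open>Positive variations and the Jordan decomposition\<close>

lemma complex_measure_uminus:
  assumes "complex_measure M \<nu>"
  shows "complex_measure M (\<lambda>A. - \<nu> A)"
  using assms unfolding complex_measure_def by (intro allI impI sums_minus) auto

lemma complex_measure_Re:
  assumes "complex_measure M \<nu>"
  shows "complex_measure M (\<lambda>A. complex_of_real (Re (\<nu> A)))"
  using assms unfolding complex_measure_def by (intro allI impI sums_of_real sums_Re) auto

lemma complex_measure_Im:
  assumes "complex_measure M \<nu>"
  shows "complex_measure M (\<lambda>A. complex_of_real (Im (\<nu> A)))"
  using assms unfolding complex_measure_def by (intro allI impI sums_of_real sums_Im) auto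

lemma sets_positive_variation [simp, measurable_cong]: "sets (positive_variation M \<nu>) = sets M"
  by (simp add: positive_variation_def)

lemma space_positive_variation [simp]: "space (positive_variation M \<nu>) = space M"
  by (simp add: positive_variation_def)

text \<open>Since the total variation is finite, \<open>measure\<close> gives its true value and is
  countably additive as a real series. It also dominates \<bar>\<nu> E\<bar>, so the half sum is
  nonnegative and \<open>ennreal\<close> does not truncate it.\<close>

lemma emeasure_positive_variation:
  assumes \<nu>: "complex_measure M (\<lambda>A. complex_of_real (\<nu> A))" and E: "E \<in> sets M"
  shows "emeasure (positive_variation M \<nu>) E =
    ennreal ((measure (total_variation M (\<lambda>A. complex_of_real (\<nu> A))) E + \<nu> E) / 2)"
proof (rule emeasure_measure_of[OF positive_variation_def])
  let ?T = "total_variation M (\<lambda>A. complex_of_real (\<nu> A))"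
  interpret finite_measure ?T
    by (rule finite_measure_total_variation[OF \<nu>])
  have nonneg: "0 \<le> (measure ?T A + \<nu> A) / 2" if "A \<in> sets M" for A
    using abs_le_measure_total_variation[OF \<nu> that] by simp
  show "positive (sets (positive_variation M \<nu>)) (\<lambda>E. ennreal ((measure ?T E + \<nu> E) / 2))"
    using complex_measure_empty[OF \<nu>] by (simp add: positive_def)
  show "countably_additive (sets (positive_variation M \<nu>)) (\<lambda>E. ennreal ((measure ?T E + \<nu> E) / 2))"
    unfolding countably_additive_def sets_positive_variation
  proof (intro allI impI)
    fix A :: "nat \<Rightarrow> 'a set"
    assume A: "range A \<subseteq> sets M" "disjoint_family A" "(\<Union>i. A i) \<in> sets M"
    have "(\<lambda>i. \<nu> (A i)) sums \<nu> (\<Union>i. A i)"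
      using complex_measure_sums[OF \<nu> A(1,2)] by (simp add: sums_of_real_iff)
    moreover have "(\<lambda>i. measure ?T (A i)) sums measure ?T (\<Union>i. A i)"
      using A by (intro finite_measure_UNION) auto
    ultimately have "(\<lambda>i. (measure ?T (A i) + \<nu> (A i)) / 2) sums ((measure ?T (\<Union>i. A i) + \<nu> (\<Union>i. A i)) / 2)"
      by (intro sums_divide sums_add)
    then show "(\<Sum>i. ennreal ((measure ?T (A i) + \<nu> (A i)) / 2))
        = ennreal ((measure ?T (\<Union>i. A i) + \<nu> (\<Union>i. A i)) / 2)"
      using A nonneg by (intro suminf_ennreal_eq) auto
  qed
qed (use E sets.space_closed in auto)

lemma finite_measure_positive_variation:
  assumes "complex_measure M (\<lambda>A. complex_of_real (\<nu> A))"
  shows "finite_measure (positive_variation M \<nu>)"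
  by (intro finite_measureI) (simp add: emeasure_positive_variation[OF assms])

lemma measure_positive_variation_diff:
  assumes \<nu>: "complex_measure M (\<lambda>A. complex_of_real (\<nu> A))" and E: "E \<in> sets M"
  shows "measure (positive_variation M \<nu>) E - measure (positive_variation M (\<lambda>A. - \<nu> A)) E = \<nu> E"
proof -
  let ?T = "total_variation M (\<lambda>A. complex_of_real (\<nu> A))"
  have neg: "complex_measure M (\<lambda>A. complex_of_real (- \<nu> A))"
    using complex_measure_uminus[OF \<nu>] by simp
  \<comment> \<open>Only moduli enter the total variation, so the two signs share it and the half
    sums differ exactly by \<nu> E.\<close>
  have "total_variation M (\<lambda>A. complex_of_real (- \<nu> A)) = ?T"
    by (simp add: total_variation_def)
  then have "measure (positive_variation M \<nu>) E = (measure ?T E + \<nu> E) / 2"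
    "measure (positive_variation M (\<lambda>A. - \<nu> A)) E = (measure ?T E - \<nu> E) / 2"
    using abs_le_measure_total_variation[OF \<nu> E]
    by (simp_all add: measure_def[of "positive_variation _ _"] emeasure_positive_variation[OF \<nu> E]
      emeasure_positive_variation[OF neg E] del: of_real_minus)
  then show ?thesis
    by (simp add: field_simps)
qed

text \<open>The half sum is at most the total variation of \<rho>, and this is compared with that of
  \<nu> partition by partition. Meant for \<rho> equal to plus or minus the real or imaginary part
  of \<nu>.\<close>

lemma positive_variation_le_total_variation:
  assumes \<nu>: "complex_measure M \<nu>" and \<rho>: "complex_measure M (\<lambda>A. complex_of_real (\<rho> A))"
    and le: "\<And>A. \<bar>\<rho> A\<bar> \<le> cmod (\<nu> A)"
  shows "positive_variation M \<rho> \<le> total_variation M \<nu>"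
proof (subst le_measure)
  let ?T = "total_variation M (\<lambda>A. complex_of_real (\<rho> A))"
  interpret finite_measure ?T
    by (rule finite_measure_total_variation[OF \<rho>])
  show "\<forall>E\<in>sets (positive_variation M \<rho>).
      emeasure (positive_variation M \<rho>) E \<le> emeasure (total_variation M \<nu>) E"
  proof
    fix E assume "E \<in> sets (positive_variation M \<rho>)"
    then have E: "E \<in> sets M" by simp
    have "emeasure (positive_variation M \<rho>) E \<le> emeasure ?T E"
      using abs_le_measure_total_variation[OF \<rho> E]
      by (simp add: emeasure_positive_variation[OF \<rho> E] emeasure_eq_measure ennreal_leI)
    also have "\<dots> = variation M (\<lambda>A. complex_of_real (\<rho> A)) E"
      by (rule emeasure_total_variation[OF \<rho> E])
    also have "\<dots> \<le> variation M \<nu> E"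
      unfolding variation_def using le by (intro SUP_mono' suminf_le) (auto intro: ennreal_leI)
    also have "\<dots> = emeasure (total_variation M \<nu>) E"
      by (rule emeasure_total_variation[OF \<nu> E, symmetric])
    finally show "emeasure (positive_variation M \<rho>) E \<le> emeasure (total_variation M \<nu>) E" .
  qed
qed simp

lemma integrable_positive_variation:
  fixes w :: "'w \<Rightarrow> 'b::{banach, second_countable_topology}"
  assumes "complex_measure M \<nu>" "complex_measure M (\<lambda>A. complex_of_real (\<rho> A))"
    and "\<And>A. \<bar>\<rho> A\<bar> \<le> cmod (\<nu> A)" and w: "integrable (total_variation M \<nu>) w"
  shows "integrable (positive_variation M \<rho>) w"
proof (rule integrableI_bounded)
  show "w \<in> borel_measurable (positive_variation M \<rho>)"
    using borel_measurable_integrable[OF w] by (simp cong: measurable_cong_sets)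
  have "(\<integral>\<^sup>+x. norm (w x) \<partial>positive_variation M \<rho>) \<le> (\<integral>\<^sup>+x. norm (w x) \<partial>total_variation M \<nu>)"
    by (intro nn_integral_mono_measure positive_variation_le_total_variation assms) simp
  also have "\<dots> < \<infinity>"
    using w by (simp add: integrable_iff_bounded)
  finally show "(\<integral>\<^sup>+x. norm (w x) \<partial>positive_variation M \<rho>) < \<infinity>" .
qed

lemma complex_measure_parts:
  assumes "complex_measure M \<nu>"
  shows "complex_measure M (\<lambda>A. complex_of_real (Re (\<nu> A)))"
    "complex_measure M (\<lambda>A. complex_of_real (- Re (\<nu> A)))"
    "complex_measure M (\<lambda>A. complex_of_real (Im (\<nu> A)))"
    "complex_measure M (\<lambda>A. complex_of_real (- Im (\<nu> A)))"
  using complex_measure_Re[OF assms] complex_measure_Im[OF assms]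
    complex_measure_uminus[OF complex_measure_Re[OF assms]]
    complex_measure_uminus[OF complex_measure_Im[OF assms]] by simp_all

section \<open>Integrals against a complex measure\<close>

text \<open>A bound integrable against the total variation is integrable against all four positive
  variations, so ordinary dominated convergence applies to each of the four integrals.\<close>

lemma complex_measure_integral_dominated_convergence:
  fixes s :: "nat \<Rightarrow> 'w \<Rightarrow> complex"
  assumes \<nu>: "complex_measure M \<nu>"
    and meas: "h \<in> borel_measurable M" "\<And>n. s n \<in> borel_measurable M"
    and w: "integrable (total_variation M \<nu>) w"
    and lim: "\<And>x. x \<in> space M \<Longrightarrow> (\<lambda>n. s n x) \<longlonglongrightarrow> h x"
    and bound: "\<And>n x. x \<in> space M \<Longrightarrow> cmod (s n x) \<le> w x"
  shows "(\<lambda>n. complex_measure_integral M \<nu> (s n)) \<longlonglongrightarrow> complex_measure_integral M \<nu> h"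
proof -
  have conv: "(\<lambda>n. integral\<^sup>L (positive_variation M \<rho>) (s n)) \<longlonglongrightarrow> integral\<^sup>L (positive_variation M \<rho>) h"
    if "complex_measure M (\<lambda>A. complex_of_real (\<rho> A))" "\<And>A. \<bar>\<rho> A\<bar> \<le> cmod (\<nu> A)" for \<rho>
  proof (rule integral_dominated_convergence)
    show "integrable (positive_variation M \<rho>) w"
      by (rule integrable_positive_variation[OF \<nu> that w])
  qed (use meas lim bound in \<open>auto cong: measurable_cong_sets\<close>)
  show ?thesis
    unfolding complex_measure_integral_def
    by (intro tendsto_add tendsto_diff tendsto_mult tendsto_const conv complex_measure_parts[OF \<nu>])
      (simp_all add: abs_Re_le_cmod abs_Im_le_cmod)
qed

lemma simple_function_positive_variation:
  "simple_function M s \<Longrightarrow> simple_function (positive_variation M \<rho>) s"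
  by (simp add: simple_function_def)

text \<open>The measure is finite, so a simple function is Bochner integrable whatever its
  support.\<close>

lemma integral_positive_variation_simple:
  fixes s :: "'w \<Rightarrow> complex"
  assumes \<rho>: "complex_measure M (\<lambda>A. complex_of_real (\<rho> A))" and s: "simple_function M s"
  shows "integral\<^sup>L (positive_variation M \<rho>) s =
    (\<Sum>y\<in>s ` space M. y * complex_of_real (measure (positive_variation M \<rho>) {x\<in>space M. s x = y}))"
proof -
  interpret finite_measure "positive_variation M \<rho>"
    by (rule finite_measure_positive_variation[OF \<rho>])
  have "Bochner_Integration.simple_bochner_integrable (positive_variation M \<rho>) s"
    by (rule simple_bochner_integrable.intros[OF simple_function_positive_variation[OF s]])
      (simp add: emeasure_eq_measure)
  from simple_bochner_integrable_eq_integral[OF this] show ?thesis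
    by (simp add: Bochner_Integration.simple_bochner_integral_def scaleR_conv_of_real mult.commute)
qed

text \<open>On each level set the positive variations of opposite sign subtract to the real or
  imaginary part of \<nu>. The resulting formula is linear in \<nu>.\<close>

lemma complex_measure_integral_simple:
  assumes \<nu>: "complex_measure M \<nu>" and s: "simple_function M s"
  shows "complex_measure_integral M \<nu> s = (\<Sum>y\<in>s ` space M. y * \<nu> {x\<in>space M. s x = y})"
proof -
  have level: "{x\<in>space M. s x = y} \<in> sets M" for y
  proof -
    have "{x\<in>space M. s x = y} = s -` {y} \<inter> space M"
      by auto
    then show ?thesis
      using simple_functionD(2)[OF s] by simp
  qed
  have diff: "integral\<^sup>L (positive_variation M \<rho>) s - integral\<^sup>L (positive_variation M (\<lambda>A. - \<rho> A)) s
      = (\<Sum>y\<in>s ` space M. y * complex_of_real (\<rho> {x\<in>space M. s x = y}))"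
    if \<rho>: "complex_measure M (\<lambda>A. complex_of_real (\<rho> A))" for \<rho>
  proof -
    have neg: "complex_measure M (\<lambda>A. complex_of_real (- \<rho> A))"
      using complex_measure_uminus[OF \<rho>] by simp
    show ?thesis
      unfolding integral_positive_variation_simple[OF \<rho> s] integral_positive_variation_simple[OF neg s]
        sum_subtractf[symmetric] right_diff_distrib[symmetric] of_real_diff[symmetric]
        measure_positive_variation_diff[OF \<rho> level] ..
  qed
  show ?thesis
    unfolding complex_measure_integral_def diff[OF complex_measure_Re[OF \<nu>]]
      diff[OF complex_measure_Im[OF \<nu>]] sum_distrib_left sum.distrib[symmetric]
  proof (rule sum.cong[OF refl])
    fix y
    show "y * complex_of_real (Re (\<nu> {x\<in>space M. s x = y}))
        + \<i> * (y * complex_of_real (Im (\<nu> {x\<in>space M. s x = y}))) = y * \<nu> {x\<in>space M. s x = y}"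
      by (subst (3) complex_eq) (simp add: algebra_simps)
  qed
qed

section \<open>Completeness of the dual and the Banach-Steinhaus theorem\<close>

text \<open>Baire's theorem will be applied on this space. A Cauchy sequence converges among the
  bounded real-linear maps, and complex homogeneity survives because it is preserved by pointwise
  limits.\<close>

instance cdual :: (complex_normed_vector) complex_banach
proof
  fix X :: "nat \<Rightarrow> 'a cdual"
  let ?X = "\<lambda>n. blinfun_of_cdual (X n)"
  assume "Cauchy X"
  then have "Cauchy ?X"
    by (simp add: Cauchy_def flip: dist_cdual.rep_eq)
  then obtain B where B: "?X \<longlonglongrightarrow> B"
    by (auto simp: Cauchy_convergent_iff convergent_def)
  have "blinfun_apply B (c *\<^sub>C x) = c * blinfun_apply B x" for c x
  proof (rule LIMSEQ_unique)
    show "(\<lambda>n. blinfun_apply (?X n) (c *\<^sub>C x)) \<longlonglongrightarrow> blinfun_apply B (c *\<^sub>C x)"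
      by (intro blinfun.tendsto B tendsto_const)
    have "blinfun_apply (?X n) (c *\<^sub>C x) = c * blinfun_apply (?X n) x" for n
      using blinfun_of_cdual[of "X n"] by (simp add: bounded_clinear_functional_def)
    then show "(\<lambda>n. blinfun_apply (?X n) (c *\<^sub>C x)) \<longlonglongrightarrow> c * blinfun_apply B x"
      by (simp add: blinfun.tendsto[OF B tendsto_const] tendsto_mult_left)
  qed
  then have "blinfun_of_cdual (Abs_cdual B) = B"
    by (intro Abs_cdual_inverse) (simp add: bounded_clinear_functional_def blinfun.bounded_linear_right)
  then have "X \<longlonglongrightarrow> Abs_cdual B"
    using B by (simp add: lim_sequentially dist_cdual.rep_eq)
  then show "convergent X"
    by (rule convergentI)
qed

text \<open>Rescaling a nonzero \<open>x\<close> to norm \<open>d / 2\<close>, strictly inside the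
  open ball, produces the constant \<open>2 * K / d\<close>.\<close>

lemma bounded_linearI_ball:
  fixes f :: "'a::real_normed_vector \<Rightarrow> 'b::real_normed_vector"
  assumes f: "linear f" and d: "0 < d" and K: "\<And>x. norm x < d \<Longrightarrow> norm (f x) \<le> K"
  shows "bounded_linear f"
proof (rule bounded_linear_intro[where K = "2 * K / d"])
  interpret linear f by fact
  show "f (x + y) = f x + f y" "f (r *\<^sub>R x) = r *\<^sub>R f x" for x y r
    by (rule add scale)+
  show "norm (f x) \<le> norm x * (2 * K / d)" for x
  proof (cases "x = 0")
    case False
    have "norm (f ((d / (2 * norm x)) *\<^sub>R x)) \<le> K"
      using d False by (intro K) simp
    then have "(d / (2 * norm x)) * norm (f x) \<le> K"
      using d by (simp add: scale)
    then show ?thesis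
      using d False by (simp add: field_simps)
  qed (simp add: zero)
qed

text \<open>Convergent sequences are bounded, so the closed sets \<open>C k\<close> of uniform bound
  \<open>k\<close> cover the space and one of them contains a ball. A bound on that ball, uniform in
  \<open>n\<close>, passes to the limit.\<close>

lemma bounded_linear_pointwise_limit:
  fixes T :: "nat \<Rightarrow> 'a::banach \<Rightarrow> 'b::real_normed_vector"
  assumes T: "\<And>n. bounded_linear (T n)" and L: "\<And>x. (\<lambda>n. T n x) \<longlonglongrightarrow> L x"
  shows "bounded_linear L"
proof -
  define C where "C k = {x. \<forall>n. norm (T n x) \<le> real k}" for k
  have "closed (C k)" for k
    unfolding C_def
    by (intro closed_Collect_all closed_Collect_le continuous_intros linear_continuous_on T)
  moreover have "(\<Union>k. C k) = UNIV"
  proof -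
    have "\<exists>k. x \<in> C k" for x
    proof -
      have "Bseq (\<lambda>n. T n x)"
        using L by (intro convergent_imp_Bseq convergentI)
      then obtain K where "\<And>n. norm (T n x) \<le> K"
        by (auto simp: Bseq_def)
      then show ?thesis
        unfolding C_def using real_arch_simple[of K] by (auto intro: order_trans)
    qed
    then show ?thesis by blast
  qed
  \<comment> \<open>If every \<open>C k\<close> had empty interior, Baire would give their union,
    the whole space, empty interior too.\<close>
  ultimately have "\<exists>k. interior (C k) \<noteq> {}"
    using Baire_category_alt[of euclidean "range C"] completely_metrizable_space_euclidean[where 'a = 'a]
    by auto
  then obtain k x0 where "x0 \<in> interior (C k)"
    by blast
  then obtain d where d: "0 < d" and ball: "ball x0 d \<subseteq> C k"
    by (auto simp: mem_interior)
  have lin: "linear L"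
  proof (rule linearI)
    show "L (x + y) = L x + L y" for x y
    proof (rule LIMSEQ_unique[OF L])
      show "(\<lambda>n. T n (x + y)) \<longlonglongrightarrow> L x + L y"
        using tendsto_add[OF L[of x] L[of y]] by (simp add: linear_simps(1)[OF T])
    qed
    show "L (r *\<^sub>R x) = r *\<^sub>R L x" for r x
    proof (rule LIMSEQ_unique[OF L])
      show "(\<lambda>n. T n (r *\<^sub>R x)) \<longlonglongrightarrow> r *\<^sub>R L x"
        using tendsto_scaleR[OF tendsto_const L[of x]] by (simp add: linear_simps(5)[OF T])
    qed
  qed
  show ?thesis
  proof (rule bounded_linearI_ball[OF lin d])
    fix x :: 'a
    assume "norm x < d"
    then have "x0 + x \<in> C k" "x0 \<in> C k"
      using ball d by (auto simp: dist_norm subset_iff)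
    then have bound: "norm (T n (x0 + x)) \<le> real k" "norm (T n x0) \<le> real k" for n
      by (auto simp: C_def)
    have "norm (T n x) \<le> 2 * real k" for n
    proof -
      \<comment> \<open>Subtracting the value at the centre moves the bound from the ball around
        \<open>x0\<close> to the ball around 0, at the price of a factor 2.\<close>
      have "T n x = T n (x0 + x) - T n x0"
        by (simp add: linear_simps(1)[OF T])
      then show ?thesis
        using norm_triangle_ineq4[of "T n (x0 + x)" "T n x0"] bound[of n] by simp
    qed
    then show "norm (L x) \<le> 2 * real k"
      by (intro LIMSEQ_le_const2[OF tendsto_norm[OF L]]) auto
  qed
qed

section \<open>Boundedness of the integral as a functional on the dual\<close>

lemma scaleC_one: "1 *\<^sub>C x = x"
  using scaleR_scaleC[of 1 x] by simp

lemma scaleC_zero: "0 *\<^sub>C x = 0"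
  using scaleR_scaleC[of 0 x] by simp

lemma bounded_clinear_functionalI_ball:
  assumes comb: "\<And>a b x y. f (a *\<^sub>C x + b *\<^sub>C y) = a * f x + b * f y"
    and d: "0 < d" "\<And>x. norm x < d \<Longrightarrow> cmod (f x) \<le> K"
  shows "bounded_clinear_functional f"
proof -
  have add: "f (x + y) = f x + f y" for x y
    using comb[of 1 x 1 y] by (simp add: scaleC_one)
  have scale: "f (c *\<^sub>C x) = c * f x" for c x
    using comb[of c x 0 x] by (simp add: scaleC_zero)
  have "linear f"
    by (rule linearI) (simp_all add: add scaleR_scaleC scale scaleC_complex_def)
  then show ?thesis
    unfolding bounded_clinear_functional_def using bounded_linearI_ball d scale by blast
qed

lemma bounded_clinear_functional_pointwise_limit:
  fixes T :: "nat \<Rightarrow> 'a::complex_banach \<Rightarrow> complex"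
  assumes T: "\<And>n. bounded_clinear_functional (T n)" and L: "\<And>x. (\<lambda>n. T n x) \<longlonglongrightarrow> L x"
  shows "bounded_clinear_functional L"
  unfolding bounded_clinear_functional_def
proof (intro conjI allI)
  show "bounded_linear L"
    using T by (intro bounded_linear_pointwise_limit[OF _ L]) (simp add: bounded_clinear_functional_def)
  show "L (c *\<^sub>C x) = c * L x" for c x
  proof (rule LIMSEQ_unique[OF L])
    show "(\<lambda>n. T n (c *\<^sub>C x)) \<longlonglongrightarrow> c * L x"
      using tendsto_mult_left[OF L[of x], of c] T by (simp add: bounded_clinear_functional_def)
  qed
qed

lemma bounded_clinear_functional_sum:
  assumes "\<And>i. i \<in> I \<Longrightarrow> bounded_clinear_functional (f i)"
  shows "bounded_clinear_functional (\<lambda>x. \<Sum>i\<in>I. c i * f i x)"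
  using assms
  by (auto simp: bounded_clinear_functional_def sum_distrib_left mult.left_commute
      intro!: bounded_linear_sum bounded_linear_const_mult sum.cong)

text \<open>The net condition for the filter \<open>nhds 0\<close> says that the value on
  \<open>E\<close> is continuous at 0. Hence it stays below 1 on some ball around 0, and linearity
  turns this into boundedness.\<close>

lemma vector_projection_family_bounded_clinear:
  assumes \<mu>: "vector_projection_family M \<mu>" and E: "E \<in> sets M"
  shows "bounded_clinear_functional (\<lambda>\<Lambda>. \<mu> \<Lambda> E)"
proof -
  have comb: "\<mu> (a *\<^sub>C \<Lambda> + b *\<^sub>C \<Gamma>) E = a * \<mu> \<Lambda> E + b * \<mu> \<Gamma> E" for a b \<Lambda> \<Gamma>
    using \<mu> E unfolding vector_projection_family_def by blast
  have "\<mu> 0 E = 0"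
    using comb[of 0 0 0 0] by (simp add: scaleC_zero)
  moreover have "setwise_tendsto M \<mu> (\<mu> 0) (nhds 0)"
    using \<mu> filterlim_ident[of "nhds 0"] unfolding vector_projection_family_def by blast
  ultimately have "((\<lambda>\<Gamma>. \<mu> \<Gamma> E) \<longlongrightarrow> 0) (nhds 0)"
    using E unfolding setwise_tendsto_def by metis
  then have "\<forall>\<^sub>F \<Gamma> in nhds 0. norm (\<mu> \<Gamma> E) < 1"
    by (simp add: tendsto_iff)
  then obtain d where "0 < d" "\<And>\<Gamma>. norm \<Gamma> < d \<Longrightarrow> cmod (\<mu> \<Gamma> E) < 1"
    by (auto simp: eventually_nhds_metric)
  then show ?thesis
    by (intro bounded_clinear_functionalI_ball[OF comb]) (auto intro: less_imp_le)
qed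

text \<open>All total variations have the measurable sets of \<open>M\<close>, so a single
  functional, here 0, reveals measurability.\<close>

lemma vp_integrable_borel_measurable:
  assumes "vp_integrable M \<mu> h"
  shows "h \<in> borel_measurable M"
proof -
  have "h \<in> borel_measurable (total_variation M (\<mu> 0))"
    using assms unfolding vp_integrable_def by (intro borel_measurable_integrable) blast
  then show ?thesis
    by (simp cong: measurable_cong_sets)
qed

text \<open>Approximate \<open>h\<close> by simple functions, whose integrals are finite combinations of the bounded
  functionals \<open>\<Lambda> \<mapsto> \<mu>\<^sub>\<Lambda>(E)\<close>, and apply the Banach--Steinhaus theorem on the complete space \<open>X\<^sup>*\<close>.\<close>

lemma vp_integral_bounded_clinear:
  assumes \<mu>: "vector_projection_family M \<mu>" and h: "vp_integrable M \<mu> h"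
  shows "bounded_clinear_functional (vp_integral M \<mu> h)"
proof -
  have \<nu>: "complex_measure M (\<mu> \<Lambda>)" for \<Lambda>
    using \<mu> unfolding vector_projection_family_def by blast
  have meas: "h \<in> borel_measurable M"
    by (rule vp_integrable_borel_measurable[OF h])
  \<comment> \<open>The approximation keeps the distance to a chosen base point within twice that of
    \<open>h\<close>; base point 0 gives the dominating function
    \<open>2 * cmod (h x)\<close>.\<close>
  obtain s where s: "\<And>n. simple_function M (s n)"
    "\<And>x. x \<in> space M \<Longrightarrow> (\<lambda>n. s n x) \<longlonglongrightarrow> h x"
    "\<And>n x. x \<in> space M \<Longrightarrow> cmod (s n x) \<le> 2 * cmod (h x)"
    using borel_measurable_implies_sequence_metric[OF meas, of 0] by simp metis
  show ?thesis
  proof (rule bounded_clinear_functional_pointwise_limit)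
    fix n
    have "{x\<in>space M. s n x = y} \<in> sets M" for y
      using simple_functionD(2)[OF s(1)[of n], of "{y}"] by (simp add: vimage_def Int_def conj_commute)
    then show "bounded_clinear_functional (vp_integral M \<mu> (s n))"
      unfolding vp_integral_def complex_measure_integral_simple[OF \<nu> s(1)]
      by (intro bounded_clinear_functional_sum vector_projection_family_bounded_clinear[OF \<mu>])
  next
    fix \<Lambda>
    show "(\<lambda>n. vp_integral M \<mu> (s n) \<Lambda>) \<longlonglongrightarrow> vp_integral M \<mu> h \<Lambda>"
      unfolding vp_integral_def
    proof (rule complex_measure_integral_dominated_convergence[OF \<nu> meas])
      show "integrable (total_variation M (\<mu> \<Lambda>)) (\<lambda>x. 2 * cmod (h x))"
        using h unfolding vp_integrable_def by (intro integrable_mult_right integrable_norm) blast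
    qed (use s in \<open>auto intro: borel_measurable_simple_function\<close>)
  qed
qed

theorem mainTheorem2:
  fixes M :: "'w measure"
    and \<mu> :: "'x::complex_banach cdual \<Rightarrow> 'w set \<Rightarrow> complex"
    and f :: "nat \<Rightarrow> 'w \<Rightarrow> real"
    and g :: "'w \<Rightarrow> real"
  assumes "vector_projection_family M \<mu>"
    and "\<And>n. vp_integrable M \<mu> (\<lambda>x. complex_of_real (f n x))"
    and "\<And>n x. x \<in> space M \<Longrightarrow> 0 \<le> f n x"
    and "\<And>n x. x \<in> space M \<Longrightarrow> f n x \<le> f (Suc n) x"
    and "\<And>x. x \<in> space M \<Longrightarrow> (\<lambda>n. f n x) \<longlonglongrightarrow> g x"
    and "vp_integrable M \<mu> (\<lambda>x. complex_of_real (g x))"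
  shows "limitin weak_star_topology
           (\<lambda>n. vp_integral M \<mu> (\<lambda>x. complex_of_real (f n x)))
           (vp_integral M \<mu> (\<lambda>x. complex_of_real (g x))) sequentially"
proof -
  \<comment> \<open>A nondecreasing sequence stays below its limit, and nonnegativity turns this
    into a bound on moduli.\<close>
  have bound: "cmod (complex_of_real (f n x)) \<le> cmod (complex_of_real (g x))" if "x \<in> space M" for n x
  proof -
    have "incseq (\<lambda>n. f n x)"
      using assms(4)[OF that] by (rule incseq_SucI)
    then have "f n x \<le> g x"
      using assms(5)[OF that] by (rule incseq_le)
    then show ?thesis
      using assms(3)[OF that, of n] by simp
  qed
  have "(\<lambda>n. vp_integral M \<mu> (\<lambda>x. complex_of_real (f n x)) \<Lambda>)
      \<longlonglongrightarrow> vp_integral M \<mu> (\<lambda>x. complex_of_real (g x)) \<Lambda>" for \<Lambda>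
    unfolding vp_integral_def
  proof (rule complex_measure_integral_dominated_convergence)
    show "complex_measure M (\<mu> \<Lambda>)"
      using assms(1) unfolding vector_projection_family_def by blast
    show "integrable (total_variation M (\<mu> \<Lambda>)) (\<lambda>x. cmod (complex_of_real (g x)))"
      using assms(6) unfolding vp_integrable_def by (intro integrable_norm) blast
  qed (use assms(5) bound in
      \<open>auto intro: tendsto_of_real vp_integrable_borel_measurable[OF assms(2)]
        vp_integrable_borel_measurable[OF assms(6)]\<close>)
  then have "limitin euclidean (\<lambda>n. vp_integral M \<mu> (\<lambda>x. complex_of_real (f n x)))
      (vp_integral M \<mu> (\<lambda>x. complex_of_real (g x))) sequentially"
    by (simp add: limitin_componentwise flip: euclidean_product_topology)
  \<comment> \<open>Convergence in the subtopology also requires the limit and eventually all terms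
    to lie in the bidual, so boundedness is invoked for the integrals of every \<open>f n\<close> as
    well as of \<open>g\<close>.\<close>
  then show ?thesis
    unfolding weak_star_topology_def limitin_subtopology
    using vp_integral_bounded_clinear[OF assms(1)] assms(2,6) by simp
qed

end
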